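(* If $R$ is an SMLL${}^0$ net in normal form for $\to$, then $R$ contains no cut links.
   Context: SMLL formulas: $A ::= 1 \mid \bot \mid X \mid X^\bot \mid A\otimes A \mid A ⅋ A$ (⅋ is "par"), involutive negation with $1^\bot=\bot$, $(A\otimes B)^\bot=A^\bot ⅋ B^\bot$. Positive formulas $P ::= 1 \mid P\otimes P$; negative $N ::= \bot \mid N ⅋ N$. SMLL${}^0$ is the unit-free fragment of SMLL: structures built only from axiom, cut, $\otimes$, ⅋ links and $n$-ary sync links (the $i$-th premiss and $i$-th conclusion of a sync link share a positive or negative type; in-edges are positive premisses and negative conclusions, out-edges positive conclusions and negative premisses); there are no one/bot links and no boxes ($1,\bot$ only appear as axiom conclusions). Such a structure is a net if it has no cyclic switching path (undirected simple path using at most one premiss of each ⅋ link and at most one out-edge of each sync link). Reduction $\to$: axiom/cut elimination; $\otimes$/⅋ cut replaced by two cuts; a sync link acting on a conclusion $A\otimes B$ (resp. $A ⅋ B$) of a $\otimes$ (resp. ⅋) link is pushed above it, acting on $A$ and $B$; a sync on a positive conclusion $P$ of an axiom moves to the other conclusion $P^\bot$; a sync on a premiss $P^\bot$ of a cut moves to the other premiss $P$. *)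

theory Defs
  imports Main "HOL-Library.Multiset"
begin

datatype 'x formula =
    One
  | Bot
  | Atom 'x
  | DualAtom 'x
  | Tensor "'x formula" "'x formula"
  | Par "'x formula" "'x formula"

primrec dual :: "'x formula \<Rightarrow> 'x formula" where
  "dual One = Bot"
| "dual Bot = One"
| "dual (Atom X) = DualAtom X"
| "dual (DualAtom X) = Atom X"
| "dual (Tensor A B) = Par (dual A) (dual B)"
| "dual (Par A B) = Tensor (dual A) (dual B)"

lemma dual_dual [simp]: "dual (dual A) = A"
  by (induction A) auto

inductive positive :: "'x formula \<Rightarrow> bool" where
  "positive One"
| "positive P \<Longrightarrow> positive Q \<Longrightarrow> positive (Tensor P Q)"

inductive negative :: "'x formula \<Rightarrow> bool" where
  "negative Bot"
| "negative N \<Longrightarrow> negative M \<Longrightarrow> negative (Par N M)"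

text \<open>An edge carries its type.  The names provide infinitely many edges of each type.\<close>

datatype 'x edge = Edge (name: nat) (ty: "'x formula")

text \<open>For \<open>TensorLink\<close> and \<open>ParLink\<close> the arguments are first premiss, second premiss,
  conclusion.  The order of the two arguments of \<open>Ax\<close> (conclusions) and of \<open>Cut\<close> (premisses) is
  irrelevant.  The argument of \<open>Sync\<close> lists the pairs of \<open>i\<close>-th premiss and \<open>i\<close>-th conclusion.\<close>

datatype 'e link =
    Ax 'e 'e
  | Cut 'e 'e
  | TensorLink 'e 'e 'e
  | ParLink 'e 'e 'e
  | Sync "('e \<times> 'e) list"

fun premisses :: "'e link \<Rightarrow> 'e list" where
  "premisses (Ax a b) = []"
| "premisses (Cut a b) = [a, b]"
| "premisses (TensorLink a b c) = [a, b]"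
| "premisses (ParLink a b c) = [a, b]"
| "premisses (Sync ps) = map fst ps"

fun conclusions :: "'e link \<Rightarrow> 'e list" where
  "conclusions (Ax a b) = [a, b]"
| "conclusions (Cut a b) = []"
| "conclusions (TensorLink a b c) = [c]"
| "conclusions (ParLink a b c) = [c]"
| "conclusions (Sync ps) = map snd ps"

fun well_typed :: "'x edge link \<Rightarrow> bool" where
  "well_typed (Ax a b) \<longleftrightarrow> ty b = dual (ty a)"
| "well_typed (Cut a b) \<longleftrightarrow> ty b = dual (ty a)"
| "well_typed (TensorLink a b c) \<longleftrightarrow> ty c = Tensor (ty a) (ty b)"
| "well_typed (ParLink a b c) \<longleftrightarrow> ty c = Par (ty a) (ty b)"
| "well_typed (Sync ps) \<longleftrightarrow>
     (\<forall>(p, q) \<in> set ps. ty p = ty q \<and> (positive (ty p) \<or> negative (ty p)))"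

text \<open>A structure is given by its links; two links are connected when an edge is a conclusion of
  one and a premiss of the other.  Every edge is a conclusion of exactly one link and a premiss of
  at most one; the edges that are premisses of no link are the conclusions of the structure.\<close>

type_synonym 'x links = "'x edge link multiset"

definition edges :: "'x links \<Rightarrow> 'x edge set" where
  "edges R = (\<Union>l \<in> set_mset R. set (premisses l) \<union> set (conclusions l))"

definition smll0_structure :: "'x links \<Rightarrow> bool" where
  "smll0_structure R \<longleftrightarrow>
     (\<forall>l \<in># R. well_typed l) \<and>
     (\<forall>e \<in> edges R. count (\<Sum>l\<in>#R. mset (conclusions l)) e = 1) \<and>
     (\<forall>e \<in> edges R. count (\<Sum>l\<in>#R. mset (premisses l)) e \<le> 1)"

text \<open>The in-edges of a sync link, which switchings do not restrict, are its remaining edges: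
  the positive premisses and the negative conclusions.\<close>

definition out_edges :: "('x edge \<times> 'x edge) list \<Rightarrow> 'x edge set" where
  "out_edges ps = {q \<in> set (map snd ps). positive (ty q)} \<union> {p \<in> set (map fst ps). negative (ty p)}"

definition joins :: "'x links \<Rightarrow> 'x edge \<Rightarrow> 'x edge link \<Rightarrow> 'x edge link \<Rightarrow> bool" where
  "joins R e l l' \<longleftrightarrow> l \<in># R \<and> l' \<in># R \<and>
     (e \<in> set (conclusions l) \<and> e \<in> set (premisses l') \<or>
      e \<in> set (premisses l) \<and> e \<in> set (conclusions l'))"

text \<open>Simple undirected paths, visiting the links \<open>ls\<close> along the edges \<open>es\<close>; the first and the last
  link may coincide.\<close>

definition simple_path :: "'x links \<Rightarrow> 'x edge link list \<Rightarrow> 'x edge list \<Rightarrow> bool" where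
  "simple_path R ls es \<longleftrightarrow>
     length ls = Suc (length es) \<and>
     (\<forall>i < length es. joins R (es ! i) (ls ! i) (ls ! Suc i)) \<and>
     distinct es \<and> distinct (butlast ls) \<and> distinct (tl ls)"

definition switching_path :: "'x links \<Rightarrow> 'x edge link list \<Rightarrow> 'x edge list \<Rightarrow> bool" where
  "switching_path R ls es \<longleftrightarrow>
     simple_path R ls es \<and>
     (\<forall>a b c. ParLink a b c \<in># R \<longrightarrow> card (set es \<inter> {a, b}) \<le> 1) \<and>
     (\<forall>ps. Sync ps \<in># R \<longrightarrow> card (set es \<inter> out_edges ps) \<le> 1)"

definition smll0_net :: "'x links \<Rightarrow> bool" where
  "smll0_net R \<longleftrightarrow>
     smll0_structure R \<and>
     \<not> (\<exists>ls es. switching_path R ls es \<and> es \<noteq> [] \<and> hd ls = last ls)"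

text \<open>Structures are considered up to renaming of edges.  In every rule, the edges on the border of
  the redex keep their name, except in \<open>ax_cut\<close>, where the edges \<open>a\<close> and \<open>c\<close> are merged, keeping
  the name \<open>a\<close>.\<close>

inductive step :: "'x links \<Rightarrow> 'x links \<Rightarrow> bool" (infix \<open>\<rightarrow>\<^sub>S\<close> 50) where
  ax_cut:
    "\<lbrakk>R = {#k, l#} + \<Gamma>; k \<in> {Ax a b, Ax b a}; l \<in> {Cut b c, Cut c b}; a \<noteq> c\<rbrakk>
     \<Longrightarrow> R \<rightarrow>\<^sub>S image_mset (map_link (id(c := a))) \<Gamma>"
| tensor_par:
    "\<lbrakk>R = {#TensorLink a b e, ParLink c d f, l#} + \<Gamma>; l \<in> {Cut e f, Cut f e}\<rbrakk>
     \<Longrightarrow> R \<rightarrow>\<^sub>S {#Cut a c, Cut b d#} + \<Gamma>"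
| sync_tensor:
    "\<lbrakk>R = {#TensorLink a b p, Sync (ps @ (p, q) # qs)#} + \<Gamma>;
      a' \<notin> edges R; b' \<notin> edges R; a' \<noteq> b'; ty a' = ty a; ty b' = ty b\<rbrakk>
     \<Longrightarrow> R \<rightarrow>\<^sub>S {#Sync (ps @ (a, a') # (b, b') # qs), TensorLink a' b' q#} + \<Gamma>"
| sync_par:
    "\<lbrakk>R = {#ParLink a b p, Sync (ps @ (p, q) # qs)#} + \<Gamma>;
      a' \<notin> edges R; b' \<notin> edges R; a' \<noteq> b'; ty a' = ty a; ty b' = ty b\<rbrakk>
     \<Longrightarrow> R \<rightarrow>\<^sub>S {#Sync (ps @ (a, a') # (b, b') # qs), ParLink a' b' q#} + \<Gamma>"
| sync_ax:
    "\<lbrakk>R = {#k, Sync (ps @ (p, q) # qs)#} + \<Gamma>; k \<in> {Ax p n, Ax n p}; positive (ty p);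
      n' \<notin> edges R; ty n' = ty n\<rbrakk>
     \<Longrightarrow> R \<rightarrow>\<^sub>S {#Ax q n', Sync (ps @ (n', n) # qs)#} + \<Gamma>"
| sync_cut:
    "\<lbrakk>R = {#l, Sync (ps @ (m, n) # qs)#} + \<Gamma>; l \<in> {Cut p n, Cut n p}; negative (ty n);
      p' \<notin> edges R; ty p' = ty p\<rbrakk>
     \<Longrightarrow> R \<rightarrow>\<^sub>S {#Cut p' m, Sync (ps @ (p, p') # qs)#} + \<Gamma>"

definition normal_form :: "'x links \<Rightarrow> bool" where
  "normal_form R \<longleftrightarrow> \<not> (\<exists>R'. R \<rightarrow>\<^sub>S R')"

end

theory Submission
  imports Defs
begin

text \<open>In a normal net no sync link has a positive conclusion: the premiss paired with it is again
  positive, and by normality can only be the conclusion of another sync link.  Climbing in this way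
  for ever, one meets the same sync link twice, and the part of the climb in between is a switching
  cycle, since it leaves each sync link through only one out-edge.  A negative conclusion of a sync
  link is not the premiss of a cut, by the rule \<open>sync_cut\<close>; an axiom above a cut is a redex unless
  the two form a cycle.  So both premisses of a cut would be conclusions of a tensor and of a par
  link, which is a redex too.\<close>

section \<open>Splitting links off a multiset\<close>

lemma mset_two_elements:
  assumes "k \<in># R" and "l \<in># R" and "k \<noteq> l"
  obtains \<Gamma> where "R = {#k, l#} + \<Gamma>"
proof -
  obtain \<Delta> where "R = add_mset k \<Delta>"
    using assms(1) multi_member_split by metis
  moreover from this obtain \<Gamma> where "\<Delta> = add_mset l \<Gamma>"
    using assms(2,3) multi_member_split by (metis insert_noteq_member)
  ultimately show thesis
    using that by simp
qed

lemma mset_three_elements: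
  assumes "k \<in># R" and "l \<in># R" and "m \<in># R" and "k \<noteq> l" and "k \<noteq> m" and "l \<noteq> m"
  obtains \<Gamma> where "R = {#k, l, m#} + \<Gamma>"
proof -
  obtain \<Delta> where \<Delta>: "R = {#k, l#} + \<Delta>"
    using mset_two_elements assms by metis
  then have "m \<in># \<Delta>"
    using assms by auto
  then obtain \<Gamma> where "\<Delta> = add_mset m \<Gamma>"
    using multi_member_split by metis
  with \<Delta> that show thesis
    by (simp add: add_mset_commute)
qed

lemma positive_not_negative: "positive A \<Longrightarrow> \<not> negative A"
  by (induction rule: positive.induct) (auto elim: negative.cases)

lemma finite_edges: "finite (edges R)"
  by (simp add: edges_def)

text \<open>The rules that move a sync link create edges outside \<open>edges R\<close>; showing
  that such a rule applies requires supplying them with the right type.\<close>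

lemma fresh_edge:
  assumes "finite E"
  obtains e :: "'x edge" where "e \<notin> E" and "ty e = A"
proof -
  have "infinite (range (\<lambda>n. Edge n A))"
    by (auto simp: inj_def dest: finite_imageD)
  then obtain e where "e \<in> range (\<lambda>n. Edge n A)" "e \<notin> E"
    using assms by (meson finite_subset subsetI)
  then show thesis
    using that by auto
qed

section \<open>Incidence of edges and links\<close>

lemma conclusion_in_edges: "l \<in># R \<Longrightarrow> e \<in> set (conclusions l) \<Longrightarrow> e \<in> edges R"
  by (auto simp: edges_def)

lemma premiss_in_edges: "l \<in># R \<Longrightarrow> e \<in> set (premisses l) \<Longrightarrow> e \<in> edges R"
  by (auto simp: edges_def)

lemma conclusion_link_unique:
  assumes R: "smll0_structure R"
    and k: "k \<in># R" "e \<in> set (conclusions k)" and l: "l \<in># R" "e \<in> set (conclusions l)"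
  shows "k = l"
proof (rule ccontr)
  assume "k \<noteq> l"
  then obtain \<Gamma> where \<Gamma>: "R = {#k, l#} + \<Gamma>"
    using mset_two_elements k l by metis
  have "count (mset (conclusions k)) e > 0" "count (mset (conclusions l)) e > 0"
    using k l by (simp_all only: count_greater_zero_iff set_mset_mset)
  moreover have "count (\<Sum>l\<in>#R. mset (conclusions l)) e = 1"
    using R conclusion_in_edges[OF k] by (simp add: smll0_structure_def)
  moreover have "count (\<Sum>l\<in>#R. mset (conclusions l)) e
    = count (mset (conclusions k)) e + count (mset (conclusions l)) e + count (\<Sum>l\<in>#\<Gamma>. mset (conclusions l)) e"
    by (simp add: \<Gamma>)
  ultimately show False
    by linarith
qed

lemma premiss_link_unique:
  assumes R: "smll0_structure R"
    and k: "k \<in># R" "e \<in> set (premisses k)" and l: "l \<in># R" "e \<in> set (premisses l)"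
  shows "k = l"
proof (rule ccontr)
  assume "k \<noteq> l"
  then obtain \<Gamma> where \<Gamma>: "R = {#k, l#} + \<Gamma>"
    using mset_two_elements k l by metis
  have "count (mset (premisses k)) e > 0" "count (mset (premisses l)) e > 0"
    using k l by (simp_all only: count_greater_zero_iff set_mset_mset)
  moreover have "count (\<Sum>l\<in>#R. mset (premisses l)) e \<le> 1"
    using R premiss_in_edges[OF k] by (simp add: smll0_structure_def)
  moreover have "count (\<Sum>l\<in>#R. mset (premisses l)) e
    = count (mset (premisses k)) e + count (mset (premisses l)) e + count (\<Sum>l\<in>#\<Gamma>. mset (premisses l)) e"
    by (simp add: \<Gamma>)
  ultimately show False
    by linarith
qed

text \<open>The bound counts occurrences, so a cut of an edge against itself would count that edge
  twice.\<close>

lemma cut_premisses_distinct: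
  assumes R: "smll0_structure R" and cut: "Cut a b \<in># R"
  shows "a \<noteq> b"
proof
  assume "a = b"
  obtain \<Gamma> where \<Gamma>: "R = add_mset (Cut a b) \<Gamma>"
    using cut multi_member_split by metis
  have "count (\<Sum>l\<in>#R. mset (premisses l)) a \<le> 1"
    using R premiss_in_edges[OF cut] by (auto simp: smll0_structure_def)
  then show False
    by (simp add: \<Gamma> \<open>a = b\<close>)
qed

lemma edge_is_conclusion:
  assumes R: "smll0_structure R" and e: "e \<in> edges R"
  obtains l where "l \<in># R" and "e \<in> set (conclusions l)"
proof -
  have "count (\<Sum>l\<in>#R. mset (conclusions l)) e = 1"
    using assms by (simp add: smll0_structure_def)
  then have "e \<in># (\<Sum>l\<in>#R. mset (conclusions l))"
    by (metis count_greater_zero_iff zero_less_one)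
  then show thesis
    using that by auto
qed

section \<open>Infinite ascents through sync links\<close>

text \<open>Indices grow upwards: \<open>e (Suc n)\<close> is a conclusion of the sync link of
  \<open>ps (Suc n)\<close> and a premiss of that of \<open>ps n\<close>. As \<open>R\<close> has
  finitely many links, one recurs, and the stretch up to the recurrence is a switching
  cycle.\<close>

lemma no_sync_ascent:
  assumes net: "smll0_net R"
    and sync: "\<And>n. Sync (ps n) \<in># R"
    and pair: "\<And>n. (e (Suc n), e n) \<in> set (ps n)"
    and pos: "\<And>n. positive (ty (e n))"
  shows False
proof -
  define L where "L n = Sync (ps n)" for n
  have R: "smll0_structure R"
    using net by (simp add: smll0_net_def)
  have L: "L n \<in># R" for n
    using sync by (simp add: L_def)
  have concl: "e n \<in> set (conclusions (L n))" and prem: "e (Suc n) \<in> set (premisses (L n))" for n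
    using pair[of n] by (force simp: L_def)+
  have "\<exists>j. \<exists>i<j. L i = L j"
  proof (rule ccontr)
    assume "\<nexists>j. \<exists>i<j. L i = L j"
    then have "inj L"
      by (metis injI linorder_neqE_nat)
    then have "infinite (range L)"
      by (auto dest: finite_imageD)
    moreover have "range L \<subseteq> set_mset R"
      using L by auto
    ultimately show False
      using finite_subset by auto
  qed
  \<comment> \<open>The least index \<open>j\<close> at which a link recurs is taken, so that the
    links below \<open>j\<close> are pairwise different and the cycle is simple.\<close>
  then obtain j where "\<exists>i<j. L i = L j" and min: "\<And>k. k < j \<Longrightarrow> \<not> (\<exists>i<k. L i = L k)"
    using exists_least_iff[of "\<lambda>j. \<exists>i<j. L i = L j"] by blast
  then obtain i where ij: "i < j" and eq: "L i = L j"
    by blast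
  have inj: "inj_on L {..<j}"
    by (rule inj_onI) (metis lessThan_iff linorder_neqE_nat min)
  have inj_tl: "inj_on L {Suc i..j}"
  proof (rule inj_onI)
    fix x y assume xy: "x \<in> {Suc i..j}" "y \<in> {Suc i..j}" "L x = L y"
    \<comment> \<open>A link equal to \<open>L j\<close> strictly between \<open>i\<close> and
      \<open>j\<close> would equal \<open>L i\<close>, a repetition below \<open>j\<close>.\<close>
    have *: "L z \<noteq> L j" if "z \<in> {Suc i..<j}" for z
      using inj_onD[OF inj, of z i] that ij eq by auto
    show "x = y"
      using xy * inj_onD[OF inj xy(3)]
      by (metis atLeastAtMost_iff atLeastLessThan_iff lessThan_iff order_le_less)
  qed
  have e_inj: "x = y" if "x \<in> {Suc i..j}" "y \<in> {Suc i..j}" "L x = L y" for x y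
    using inj_onD[OF inj_tl] that by blast
  \<comment> \<open>The path from \<open>L i\<close> to \<open>L j\<close> crosses
    \<open>e (Suc k)\<close> between \<open>L k\<close> and \<open>L (Suc k)\<close>, so its edges
    start at index \<open>Suc i\<close>.\<close>
  define ls where "ls = map L [i..<Suc j]"
  define es where "es = map e [Suc i..<Suc j]"
  have es: "set es = e ` {Suc i..j}"
    by (auto simp: es_def)
  have "simple_path R ls es"
    unfolding simple_path_def
  proof (intro conjI allI impI)
    show "length ls = Suc (length es)"
      using ij by (simp add: ls_def es_def)
    fix k assume k: "k < length es"
    then have "es ! k = e (Suc (i + k))" "ls ! k = L (i + k)" "ls ! Suc k = L (Suc (i + k))"
      by (simp_all add: ls_def es_def del: upt_Suc)
    then show "joins R (es ! k) (ls ! k) (ls ! Suc k)"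
      using L concl prem by (simp add: joins_def)
  next
    \<comment> \<open>An edge determines the link it is a conclusion of, so \<open>e\<close>
      inherits injectivity from \<open>L\<close>.\<close>
    show "distinct es"
      unfolding es_def distinct_map
    proof (intro conjI inj_onI)
      fix x y assume "x \<in> set [Suc i..<Suc j]" "y \<in> set [Suc i..<Suc j]" "e x = e y"
      then show "x = y"
        using conclusion_link_unique[OF R L concl L, of x y] concl[of y] e_inj[of x y] by auto
    qed simp
    show "distinct (butlast ls)"
      using ij by (auto simp: ls_def distinct_map intro: inj_on_subset[OF inj])
    have "tl ls = map L [Suc i..<Suc j]"
      using ij by (simp add: ls_def upt_conv_Cons del: upt_Suc)
    then show "distinct (tl ls)"
      using inj_tl by (simp add: distinct_map atLeastLessThanSuc_atLeastAtMost del: upt_Suc)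
  qed
  moreover have "card (set es \<inter> {a, b}) \<le> 1" if par: "ParLink a b c \<in># R" for a b c
  proof -
    have "e k \<notin> {a, b}" if "k \<in> {Suc i..j}" for k
    proof
      assume "e k \<in> {a, b}"
      \<comment> \<open>\<open>k - 1\<close> is a true predecessor because \<open>k\<close> is at
        least \<open>Suc i\<close>; thus \<open>e k\<close> is a premiss of a sync link, not of a
        par link.\<close>
      then have "L (k - 1) = ParLink a b c"
        using premiss_link_unique[OF R L prem par, of "k - 1"] that by auto
      then show False
        by (simp add: L_def)
    qed
    then have "set es \<inter> {a, b} = {}"
      unfolding es by blast
    then show ?thesis
      by simp
  qed
  moreover have "card (set es \<inter> out_edges qs) \<le> 1" if qs: "Sync qs \<in># R" for qs
  proof -
    \<comment> \<open>A positive edge can be an out-edge only as a conclusion, so an out-edge of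
      \<open>Sync qs\<close> on the path is some \<open>e x\<close> with
      \<open>L x = Sync qs\<close>, and at most one such \<open>x\<close> lies in the range.\<close>
    have out: "L x = Sync qs" if "e x \<in> out_edges qs" for x
      using that positive_not_negative[OF pos[of x]] conclusion_link_unique[OF R L concl qs, of x]
      by (auto simp: out_edges_def)
    have "x = y" if "x \<in> set es \<inter> out_edges qs" "y \<in> set es \<inter> out_edges qs" for x y
    proof -
      from that obtain m n where "x = e m" "y = e n" "m \<in> {Suc i..j}" "n \<in> {Suc i..j}"
        unfolding es by blast
      then show ?thesis
        using that out[of m] out[of n] e_inj[of m n] by simp
    qed
    then show ?thesis
      by (metis One_nat_def card_le_Suc0_iff_eq finite_Int finite_set)
  qed
  ultimately have "switching_path R ls es"
    by (simp add: switching_path_def)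
  moreover have "es \<noteq> []" "hd ls = last ls"
    using ij eq by (auto simp: es_def ls_def hd_map last_map hd_append)
  ultimately show False
    using net by (auto simp: smll0_net_def)
qed

section \<open>Sync links and cut premisses in normal nets\<close>

text \<open>Each positive conclusion forces another one directly above it; dependent choice turns
  this into an ascent that \<open>no_sync_ascent\<close> forbids.\<close>

lemma normal_net_no_positive_sync_conclusion:
  assumes net: "smll0_net R" and nf: "normal_form R" and sync: "Sync ps \<in># R"
    and pq: "(p, q) \<in> set ps" and pos: "positive (ty q)"
  shows False
proof -
  have R: "smll0_structure R"
    using net by (simp add: smll0_net_def)
  \<comment> \<open>An axiom or a tensor link above \<open>p\<close> gives a redex and the
    conclusion of a par link is not positive, so only another sync link can conclude
    \<open>p\<close>.\<close>
  have climb: "\<exists>qs o'. Sync qs \<in># R \<and> (o', p) \<in> set qs \<and> positive (ty p)"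
    if sync: "Sync ps \<in># R" and pq: "(p, q) \<in> set ps" and pos: "positive (ty q)" for ps p q
  proof -
    have pos_p: "positive (ty p)"
      using R sync pq pos by (fastforce simp: smll0_structure_def)
    have "p \<in> set (premisses (Sync ps))"
      using pq by force
    then have "p \<in> edges R"
      using sync premiss_in_edges by metis
    then obtain l where l: "l \<in># R" "p \<in> set (conclusions l)"
      using edge_is_conclusion[OF R] by metis
    have wt: "well_typed l"
      using R l by (simp add: smll0_structure_def)
    obtain xs ys where ps: "ps = xs @ (p, q) # ys"
      using pq split_list by metis
    show ?thesis
    proof (cases l)
      case (Ax a b)
      obtain n where n: "l \<in> {Ax p n, Ax n p}"
        using Ax l by auto
      obtain \<Gamma> where \<Gamma>: "R = {#l, Sync (xs @ (p, q) # ys)#} + \<Gamma>"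
        using mset_two_elements[OF l(1) sync] Ax ps by auto
      obtain n' where n': "n' \<notin> edges R" "ty n' = ty n"
        using fresh_edge[OF finite_edges] by metis
      show ?thesis
        using step.sync_ax[OF \<Gamma> n pos_p n'] nf by (auto simp: normal_form_def)
    next
      case (Cut a b)
      with l show ?thesis by simp
    next
      case (TensorLink a b c)
      with l have "l = TensorLink a b p" by simp
      then obtain \<Gamma> where \<Gamma>: "R = {#TensorLink a b p, Sync (xs @ (p, q) # ys)#} + \<Gamma>"
        using mset_two_elements[OF l(1) sync] ps by auto
      obtain a' where a': "a' \<notin> edges R" "ty a' = ty a"
        using fresh_edge[OF finite_edges] by metis
      obtain b' where b': "b' \<notin> insert a' (edges R)" "ty b' = ty b"
        using fresh_edge finite_edges by (metis finite_insert)
      show ?thesis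
        using step.sync_tensor[OF \<Gamma> a'(1) _ _ a'(2) b'(2)] b'(1) nf
        by (auto simp: normal_form_def)
    next
      case (ParLink a b c)
      with l wt have "ty p = Par (ty a) (ty b)" by simp
      with pos_p show ?thesis
        by (auto elim: positive.cases)
    next
      case (Sync qs)
      with l pos_p show ?thesis by fastforce
    qed
  qed
  \<comment> \<open>A state of the climb: the list of a sync link and one of its pairs. The
    conclusion of the next state will be the present premiss.\<close>
  define P where "P t \<longleftrightarrow> Sync (fst t) \<in># R \<and> snd t \<in> set (fst t) \<and> positive (ty (snd (snd t)))"
    for t
  have "\<exists>t'. P t' \<and> snd (snd t') = fst (snd t)" if t: "P t" for t
  proof -
    obtain qs o' where "Sync qs \<in># R" "(o', fst (snd t)) \<in> set qs" "positive (ty (fst (snd t)))"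
      using climb[of "fst t" "fst (snd t)" "snd (snd t)"] t by (auto simp: P_def)
    then show ?thesis
      by (intro exI[of _ "(qs, o', fst (snd t))"]) (simp add: P_def)
  qed
  moreover have "P (ps, p, q)"
    using sync pq pos by (simp add: P_def)
  ultimately obtain f where f: "\<And>n. P (f n)" "\<And>n. snd (snd (f (Suc n))) = fst (snd (f n))"
    using dependent_nat_choice[of "\<lambda>_. P" "\<lambda>_ t t'. snd (snd t') = fst (snd t)"] by metis
  show False
    by (rule no_sync_ascent[OF net, of "\<lambda>n. fst (f n)" "\<lambda>n. snd (snd (f n))"])
      (use f in \<open>simp_all add: P_def\<close>)
qed

text \<open>A positive sync conclusion is excluded already, a negative one meets
  \<open>sync_cut\<close>, and an axiom gives a redex or a cycle. Admitting both orders of the cut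
  lets the lemma serve for either premiss.\<close>

lemma normal_net_cut_premiss:
  assumes net: "smll0_net R" and nf: "normal_form R"
    and cut: "l \<in># R" "l \<in> {Cut a b, Cut b a}"
  obtains x y where "TensorLink x y a \<in># R" | x y where "ParLink x y a \<in># R"
proof -
  have R: "smll0_structure R"
    using net by (simp add: smll0_net_def)
  have ab: "a \<noteq> b"
    using cut_premisses_distinct[OF R] cut by auto
  have "a \<in> edges R"
    using premiss_in_edges[OF cut(1)] cut(2) by auto
  then obtain k where k: "k \<in># R" "a \<in> set (conclusions k)"
    using edge_is_conclusion[OF R] by metis
  show thesis
  proof (cases k)
    case (Ax c d)
    obtain a' where a': "k \<in> {Ax a' a, Ax a a'}"
      using Ax k by auto
    obtain \<Gamma> where \<Gamma>: "R = {#k, l#} + \<Gamma>"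
      using mset_two_elements[OF k(1) cut(1)] Ax cut(2) by auto
    \<comment> \<open>Normality defeats \<open>ax_cut\<close> only through its side condition that
      the merged edges differ.\<close>
    have "a' = b"
      using step.ax_cut[OF \<Gamma> a' cut(2)] nf by (auto simp: normal_form_def)
    \<comment> \<open>The axiom and the cut are thus joined by both edges. Since no other link
      touches these, no par or sync link restricts the cycle.\<close>
    have prem: "m = l" if "m \<in># R" "{a, b} \<inter> set (premisses m) \<noteq> {}" for m
      using premiss_link_unique[OF R that(1) _ cut(1)] that(2) cut(2) by auto
    have concl: "m = k" if "m \<in># R" "{a, b} \<inter> set (conclusions m) \<noteq> {}" for m
      using conclusion_link_unique[OF R that(1) _ k(1)] that(2) a' \<open>a' = b\<close> by auto
    have "simple_path R [k, l, k] [a, b]"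
      using k cut a' \<open>a' = b\<close> ab
      by (auto simp: simple_path_def joins_def less_Suc_eq)
    moreover have "card (set [a, b] \<inter> {x, y}) \<le> 1" if "ParLink x y z \<in># R" for x y z
    proof -
      have "set [a, b] \<inter> {x, y} = {}"
        using prem[OF that] cut(2) by auto
      then show ?thesis by simp
    qed
    moreover have "card (set [a, b] \<inter> out_edges ps) \<le> 1" if "Sync ps \<in># R" for ps
    proof -
      have "{a, b} \<inter> set (map fst ps) = {}" "{a, b} \<inter> set (map snd ps) = {}"
        using prem[OF that] concl[OF that] cut(2) Ax by auto
      then have "set [a, b] \<inter> out_edges ps = {}"
        unfolding out_edges_def by auto
      then show ?thesis by simp
    qed
    ultimately have "switching_path R [k, l, k] [a, b]"
      unfolding switching_path_def by blast
    then show thesis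
      using net by (force simp: smll0_net_def)
  next
    case (Sync ps)
    then obtain m where m: "(m, a) \<in> set ps"
      using k by auto
    then obtain xs ys where ps: "ps = xs @ (m, a) # ys"
      using split_list by metis
    \<comment> \<open>Sync links act only on positive or negative types, so ruling out positive
      leaves the polarity that \<open>sync_cut\<close> needs.\<close>
    have "\<not> positive (ty a)"
      using normal_net_no_positive_sync_conclusion[OF net nf _ m] k Sync by auto
    moreover have "well_typed k"
      using R k by (simp add: smll0_structure_def)
    ultimately have neg: "negative (ty a)"
      using m Sync by auto
    obtain \<Gamma> where \<Gamma>: "R = {#l, Sync (xs @ (m, a) # ys)#} + \<Gamma>"
      using mset_two_elements[OF cut(1) k(1)] Sync ps cut(2) by auto
    obtain p' where p': "p' \<notin> edges R" "ty p' = ty b"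
      using fresh_edge[OF finite_edges] by metis
    have "l \<in> {Cut b a, Cut a b}"
      using cut(2) by auto
    then show thesis
      using step.sync_cut[OF \<Gamma> _ neg p'] nf by (auto simp: normal_form_def)
  qed (use k that in auto)
qed

section \<open>Cuts between a tensor and a par link\<close>

theorem mainTheorem6:
  fixes R :: "'x links"
  assumes "smll0_net R" and "normal_form R"
  shows "\<not> (\<exists>a b. Cut a b \<in># R)"
proof
  assume "\<exists>a b. Cut a b \<in># R"
  then obtain a b where cut: "Cut a b \<in># R"
    by blast
  have wt: "\<And>l. l \<in># R \<Longrightarrow> well_typed l"
    using assms(1) by (simp add: smll0_net_def smll0_structure_def)
  have no_redex: False
    if tensor: "TensorLink x y e \<in># R" and par: "ParLink z w f \<in># R"
      and l: "l \<in># R" "l \<in> {Cut e f, Cut f e}" for x y z w e f l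
  proof -
    obtain \<Gamma> where "R = {#TensorLink x y e, ParLink z w f, l#} + \<Gamma>"
      using mset_three_elements[OF tensor par l(1)] l(2) by auto
    from step.tensor_par[OF this l(2)] show False
      using assms(2) by (auto simp: normal_form_def)
  qed
  have ty_b: "ty b = dual (ty a)"
    using wt[OF cut] by simp
  have a_cases: "(\<exists>x y. TensorLink x y a \<in># R) \<or> (\<exists>x y. ParLink x y a \<in># R)"
    by (rule normal_net_cut_premiss[OF assms cut, of a b]) auto
  have b_cases: "(\<exists>x y. TensorLink x y b \<in># R) \<or> (\<exists>x y. ParLink x y b \<in># R)"
    by (rule normal_net_cut_premiss[OF assms cut, of b a]) auto
  show False
    using a_cases
  proof (elim disjE exE)
    \<comment> \<open>The types of \<open>a\<close> and \<open>b\<close> are dual, so two tensor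
      links cannot face each other across the cut, and neither can two par links.\<close>
    fix x y assume a: "TensorLink x y a \<in># R"
    then have "\<nexists>z w. TensorLink z w b \<in># R"
      using wt[OF a] wt ty_b by fastforce
    then show False
      using b_cases no_redex[OF a _ cut] by blast
  next
    fix x y assume a: "ParLink x y a \<in># R"
    then have "\<nexists>z w. ParLink z w b \<in># R"
      using wt[OF a] wt ty_b by fastforce
    then show False
      using b_cases no_redex[OF _ a cut] by blast
  qed
qed

end
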